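(* Let $F$ be a singular fiber of Kodaira type $I_n$ with $n\geq3$ of an elliptic fibration $g\colon X\to\mathbb P^1$ on a smooth $K3$ surface $X$. Let $R$ be an ADER in $F$. Then $R$ is of type $$A_{\lambda_1}\oplus\cdots\oplus A_{\lambda_r}$$ for some integers $\lambda_1,\dots,\lambda_r\geq1$ satisfying $$\lambda_1+\cdots+\lambda_r+r\leq n.$$ Conversely, every such type occurs as an ADER in $F$.
   Context: We work over an algebraically closed field of characteristic $0$. A fiber of Kodaira type $I_n$ ($n\ge3$) is a reduced cycle of $n$ smooth rational $(-2)$-curves: its dual graph is a cycle with $n$ vertices, adjacent components meeting transversely at one point. An ADE reduced divisor (ADER) in a singular fiber $F$ is a nonzero reduced subdivisor of $F$ consisting of smooth rational $(-2)$-curves whose dual graph (vertices: components; two vertices joined by as many edges as the intersection number of the two curves) is a disjoint union of Dynkin diagrams of type $A_k$, $D_l$ ($l\ge4$), $E_6,E_7,E_8$. Its type is the type of this graph; $\oplus$ denotes disjoint union of Dynkin diagrams. *)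

theory Defs
  imports
    "HOL-Analysis.Abstract_Topology"
    "HOL-Library.Poly_Mapping"
    "HOL-Library.Function_Algebras"
    "HOL-Computational_Algebra.Polynomial"
begin

section \<open>Projective varieties\<close>

text \<open>
  Classical projective geometry over an algebraically closed field. Polynomials have variables
  \<open>x\<^sub>0, x\<^sub>1, \<dots>\<close>, and \<open>P\<^sup>N\<close> is embedded in \<open>P\<^sup>M\<close> (\<open>N \<le> M\<close>) by putting the remaining coordinates
  to \<open>0\<close>; hence the ambient dimension is only mentioned where projectivity is asserted.
  A point is the set of all its homogeneous coordinate vectors.
\<close>

type_synonym 'k mpol = "(nat \<Rightarrow>\<^sub>0 nat) \<Rightarrow>\<^sub>0 'k"
type_synonym 'k vec = "nat \<Rightarrow> 'k"
type_synonym 'k point = "'k vec set"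

definition peval :: "'k::field mpol \<Rightarrow> 'k vec \<Rightarrow> 'k" where
  "peval f a = (\<Sum>m\<in>Poly_Mapping.keys f. Poly_Mapping.lookup f m *
      (\<Prod>i\<in>Poly_Mapping.keys m. a i ^ Poly_Mapping.lookup m i))"

text \<open>The formal differential of \<open>f\<close> at \<open>a\<close> in direction \<open>v\<close>, that is \<open>\<Sum>\<^sub>i (\<partial>f/\<partial>x\<^sub>i)(a) v\<^sub>i\<close>.\<close>

definition pdiff :: "'k::field mpol \<Rightarrow> 'k vec \<Rightarrow> 'k vec \<Rightarrow> 'k" where
  "pdiff f a v = (\<Sum>m\<in>Poly_Mapping.keys f. Poly_Mapping.lookup f m *
      (\<Sum>i\<in>Poly_Mapping.keys m.
        of_nat (Poly_Mapping.lookup m i) * a i ^ (Poly_Mapping.lookup m i - 1) * v i *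
        (\<Prod>j\<in>Poly_Mapping.keys m - {i}. a j ^ Poly_Mapping.lookup m j)))"

definition homogeneous :: "nat \<Rightarrow> 'k::field mpol \<Rightarrow> bool" where
  "homogeneous d f \<longleftrightarrow>
    (\<forall>m\<in>Poly_Mapping.keys f. (\<Sum>i\<in>Poly_Mapping.keys m. Poly_Mapping.lookup m i) = d)"

definition proj_point :: "'k::field vec \<Rightarrow> 'k point" where
  "proj_point a = {\<lambda>i. c * a i | c. c \<noteq> 0}"

definition proj_space :: "nat \<Rightarrow> 'k::field point set" where
  "proj_space N = {proj_point a | a. (\<exists>i. a i \<noteq> 0) \<and> (\<forall>i>N. a i = 0)}"

definition zariski :: "'k::field point topology" where
  "zariski = topology_generated_by
    {{p \<in> (\<Union>N. proj_space N). \<forall>a\<in>p. peval f a \<noteq> 0} | f. \<exists>d. homogeneous d f}"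

definition zirreducible :: "'k::field point set \<Rightarrow> bool" where
  "zirreducible Z \<longleftrightarrow> Z \<noteq> {} \<and>
    (\<forall>A B. closedin (subtopology zariski Z) A \<and> closedin (subtopology zariski Z) B \<and> Z = A \<union> B
      \<longrightarrow> Z = A \<or> Z = B)"

definition irreducible_chain ::
  "'k::field point set \<Rightarrow> nat \<Rightarrow> (nat \<Rightarrow> 'k point set) \<Rightarrow> bool" where
  "irreducible_chain Y e Z \<longleftrightarrow>
    (\<forall>i\<le>e. closedin (subtopology zariski Y) (Z i) \<and> zirreducible (Z i)) \<and>
    (\<forall>i<e. Z i \<subset> Z (Suc i))"

definition has_dim :: "'k::field point set \<Rightarrow> nat \<Rightarrow> bool" where
  "has_dim Y d \<longleftrightarrow> (\<exists>Z. irreducible_chain Y d Z) \<and> (\<forall>e Z. irreducible_chain Y e Z \<longrightarrow> e \<le> d)"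

definition projective_variety :: "'k::field point set \<Rightarrow> bool" where
  "projective_variety X \<longleftrightarrow>
    zirreducible X \<and> (\<exists>N. closedin (subtopology zariski (proj_space N)) X)"


section \<open>Dimensions of quotient vector spaces\<close>

text \<open>All vector spaces below are spaces of \<open>'k\<close>-valued functions.\<close>

abbreviation fscale :: "'k::field \<Rightarrow> ('x \<Rightarrow> 'k) \<Rightarrow> 'x \<Rightarrow> 'k" where
  "fscale \<equiv> \<lambda>c \<phi> x. c * \<phi> x"

text \<open>The dimension of \<open>V / (span W)\<close>, for \<open>W \<subseteq> V\<close> with finite-dimensional quotient.\<close>

definition quotient_dim :: "('x \<Rightarrow> 'k::field) set \<Rightarrow> ('x \<Rightarrow> 'k) set \<Rightarrow> nat" where
  "quotient_dim V W =
    (LEAST n. \<exists>B. B \<subseteq> V \<and> finite B \<and> card B = n \<and> V \<subseteq> module.span fscale (W \<union> B))"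


section \<open>Regular functions, morphisms and smoothness\<close>

text \<open>A pair \<open>(f, g)\<close> of forms of the same degree stands for the function \<open>f / g\<close>.\<close>

type_synonym 'k frac = "'k mpol \<times> 'k mpol"

definition frac_on :: "'k::field point set \<Rightarrow> 'k frac \<Rightarrow> bool" where
  "frac_on V h \<longleftrightarrow> (\<exists>d. homogeneous d (fst h) \<and> homogeneous d (snd h)) \<and>
    (\<forall>q\<in>V. \<forall>a\<in>q. peval (snd h) a \<noteq> 0)"

definition feval :: "'k::field frac \<Rightarrow> 'k vec \<Rightarrow> 'k" where
  "feval h a = peval (fst h) a / peval (snd h) a"

definition fdiff :: "'k::field frac \<Rightarrow> 'k vec \<Rightarrow> 'k vec \<Rightarrow> 'k" where
  "fdiff h a v = (pdiff (fst h) a v * peval (snd h) a - peval (fst h) a * pdiff (snd h) a v)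
      / (peval (snd h) a)\<^sup>2"

text \<open>Only the values of \<open>\<phi>\<close> on \<open>U\<close> matter; elsewhere they are arbitrary.\<close>

definition regular_fun :: "'k::field point set \<Rightarrow> ('k point \<Rightarrow> 'k) \<Rightarrow> bool" where
  "regular_fun U \<phi> \<longleftrightarrow> (\<forall>p\<in>U. \<exists>V h. openin (subtopology zariski U) V \<and> p \<in> V \<and>
      frac_on V h \<and> (\<forall>q\<in>V. \<forall>a\<in>q. \<phi> q = feval h a))"

definition morphism ::
  "'k::field point set \<Rightarrow> 'k point set \<Rightarrow> ('k point \<Rightarrow> 'k point) \<Rightarrow> bool" where
  "morphism X Y g \<longleftrightarrow> g ` X \<subseteq> Y \<and>
    (\<forall>p\<in>X. \<exists>V d f. openin (subtopology zariski X) V \<and> p \<in> V \<and>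
      (\<forall>i. homogeneous d (f i)) \<and> (\<forall>q\<in>V. \<forall>a\<in>q. (\<lambda>i. peval (f i) a) \<in> g q))"

definition isomorphic_varieties :: "'k::field point set \<Rightarrow> 'k point set \<Rightarrow> bool" where
  "isomorphic_varieties X Y \<longleftrightarrow> (\<exists>g h. morphism X Y g \<and> morphism Y X h \<and>
    (\<forall>p\<in>X. h (g p) = p) \<and> (\<forall>q\<in>Y. g (h q) = q))"

text \<open>
  The tangent space at \<open>a\<close> of the affine cone over \<open>X\<close>. Since the coordinate \<open>x\<^sub>i\<close> vanishes on
  \<open>X \<subseteq> P\<^sup>N\<close> for \<open>i > N\<close>, it is contained in \<open>k\<^sup>N\<^sup>+\<^sup>1\<close>.
\<close>

definition cone_tangent :: "'k::field point set \<Rightarrow> 'k vec \<Rightarrow> 'k vec set" where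
  "cone_tangent X a = {v. \<forall>d f. homogeneous d f \<and> (\<forall>q\<in>X. \<forall>b\<in>q. peval f b = 0)
      \<longrightarrow> pdiff f a v = 0}"

definition smooth_of_dim :: "'k::field point set \<Rightarrow> nat \<Rightarrow> bool" where
  "smooth_of_dim X d \<longleftrightarrow> has_dim X d \<and>
    (\<forall>p\<in>X. \<forall>a\<in>p. vector_space.dim fscale (cone_tangent X a) = Suc d)"

text \<open>
  \<open>h\<^sup>1(X, O\<^sub>X)\<close>, computed as Cech cohomology with respect to the cover of \<open>X\<close> by the affine open
  subsets \<open>x\<^sub>i \<noteq> 0\<close>.
\<close>

definition std_open :: "'k::field point set \<Rightarrow> nat \<Rightarrow> 'k point set" where
  "std_open X i = {p\<in>X. \<forall>a\<in>p. a i \<noteq> 0}"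

definition cech_cocycles :: "'k::field point set \<Rightarrow> (nat \<times> nat \<times> 'k point \<Rightarrow> 'k) set" where
  "cech_cocycles X = {c.
    (\<forall>i j. regular_fun (std_open X i \<inter> std_open X j) (\<lambda>p. c (i, j, p))) \<and>
    (\<forall>i j l. \<forall>p \<in> std_open X i \<inter> std_open X j \<inter> std_open X l.
      c (i, l, p) = c (i, j, p) + c (j, l, p))}"

definition cech_coboundaries :: "'k::field point set \<Rightarrow> (nat \<times> nat \<times> 'k point \<Rightarrow> 'k) set" where
  "cech_coboundaries X = {c. \<exists>b. (\<forall>i. regular_fun (std_open X i) (b i)) \<and>
    (\<forall>i j. \<forall>p \<in> std_open X i \<inter> std_open X j. c (i, j, p) = b j p - b i p)}"

definition h1_O :: "'k::field point set \<Rightarrow> nat" where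
  "h1_O X = quotient_dim (cech_cocycles X) (cech_coboundaries X)"

text \<open>
  The canonical bundle of a smooth surface is trivial iff there is a nowhere vanishing regular
  2-form \<open>\<omega>\<close>. Locally \<open>\<omega>\<close> is a sum of terms \<open>\<phi> d\<psi> \<and> d\<chi>\<close>; it is written as an alternating form on
  the tangent spaces of the affine cone, where the differential of a quotient of forms of the same
  degree kills the radial direction.
\<close>

definition trivial_canonical_bundle :: "'k::field point set \<Rightarrow> bool" where
  "trivial_canonical_bundle X \<longleftrightarrow> (\<exists>\<omega> :: 'k vec \<Rightarrow> 'k vec \<Rightarrow> 'k vec \<Rightarrow> 'k.
    (\<forall>p\<in>X. \<exists>V r \<phi> \<psi> \<chi>. openin (subtopology zariski X) V \<and> p \<in> V \<and>
      (\<forall>l<(r::nat). frac_on V (\<phi> l) \<and> frac_on V (\<psi> l) \<and> frac_on V (\<chi> l)) \<and>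
      (\<forall>q\<in>V. \<forall>a\<in>q. \<forall>v\<in>cone_tangent X a. \<forall>w\<in>cone_tangent X a.
        \<omega> a v w = (\<Sum>l<r. feval (\<phi> l) a *
          (fdiff (\<psi> l) a v * fdiff (\<chi> l) a w - fdiff (\<psi> l) a w * fdiff (\<chi> l) a v)))) \<and>
    (\<forall>p\<in>X. \<forall>a\<in>p. \<exists>v\<in>cone_tangent X a. \<exists>w\<in>cone_tangent X a. \<omega> a v w \<noteq> 0))"

definition K3_surface :: "'k::field point set \<Rightarrow> bool" where
  "K3_surface X \<longleftrightarrow> projective_variety X \<and> smooth_of_dim X 2 \<and>
    trivial_canonical_bundle X \<and> h1_O X = 0"


section \<open>Curves, divisors and intersection numbers on a smooth projective surface\<close>

text \<open>
  The local ring of \<open>X\<close> at \<open>p\<close> and the ideal of \<open>C\<close> in it, as sets of functions on all points that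
  are regular near \<open>p\<close>. Functions that agree near \<open>p\<close> are not identified; those that are \<open>0\<close> near \<open>p\<close>
  belong to every \<open>local_ideal\<close>, so quotients by such ideals are the right ones.
\<close>

definition local_ring :: "'k::field point set \<Rightarrow> 'k point \<Rightarrow> ('k point \<Rightarrow> 'k) set" where
  "local_ring X p = {\<phi>. \<exists>V. openin (subtopology zariski X) V \<and> p \<in> V \<and> regular_fun V \<phi>}"

definition local_ideal ::
  "'k::field point set \<Rightarrow> 'k point set \<Rightarrow> 'k point \<Rightarrow> ('k point \<Rightarrow> 'k) set" where
  "local_ideal X C p = {\<phi>. \<exists>V. openin (subtopology zariski X) V \<and> p \<in> V \<and> regular_fun V \<phi> \<and>
    (\<forall>q\<in>V \<inter> C. \<phi> q = 0)}"

definition curves :: "'k::field point set \<Rightarrow> 'k point set set" where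
  "curves X = {C. closedin (subtopology zariski X) C \<and> zirreducible C \<and> has_dim C 1}"

definition local_equation ::
  "'k::field point set \<Rightarrow> 'k point set \<Rightarrow> 'k point \<Rightarrow> ('k point \<Rightarrow> 'k) \<Rightarrow> bool" where
  "local_equation X C p u \<longleftrightarrow> u \<in> local_ideal X C p \<and>
    (\<forall>\<phi>\<in>local_ideal X C p. \<exists>w\<in>local_ring X p. \<exists>V.
      openin (subtopology zariski X) V \<and> p \<in> V \<and> (\<forall>q\<in>V. \<phi> q = u q * w q))"

text \<open>
  A nonzero rational function on \<open>X\<close> is a function that is regular and nonzero on some nonempty open
  subset; its values elsewhere are irrelevant.
\<close>

definition nonzero_rational :: "'k::field point set \<Rightarrow> ('k point \<Rightarrow> 'k) \<Rightarrow> bool" where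
  "nonzero_rational X \<phi> \<longleftrightarrow> (\<exists>U. openin (subtopology zariski X) U \<and> U \<noteq> {} \<and>
    regular_fun U \<phi> \<and> (\<forall>q\<in>U. \<phi> q \<noteq> 0))"

text \<open>
  The order of \<open>\<phi>\<close> along \<open>C\<close> is the exponent \<open>n\<close> in \<open>\<phi> = u\<^sup>n w\<close> near some point of \<open>C\<close>, with \<open>u\<close>
  a local equation of \<open>C\<close> and \<open>w\<close> invertible. Such a point exists: any point of \<open>C\<close> on no other
  component of the divisor of \<open>\<phi>\<close>, nor on a curve other than \<open>C\<close> along which \<open>\<phi>\<close> has irrelevant
  values.
\<close>

definition ord_along :: "'k::field point set \<Rightarrow> 'k point set \<Rightarrow> ('k point \<Rightarrow> 'k) \<Rightarrow> int" where
  "ord_along X C \<phi> = (THE n. \<exists>p\<in>C. \<exists>V u w. openin (subtopology zariski X) V \<and> p \<in> V \<and>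
    local_equation X C p u \<and> regular_fun V w \<and> (\<forall>q\<in>V. w q \<noteq> 0) \<and>
    (\<forall>q\<in>V - C. \<phi> q = u q powi n * w q))"

type_synonym 'k divisor = "'k point set \<Rightarrow> int"

definition components :: "'k divisor \<Rightarrow> 'k point set set" where
  "components D = {C. D C \<noteq> 0}"

definition prime_divisor :: "'k point set \<Rightarrow> 'k divisor" where
  "prime_divisor C = (\<lambda>E. if E = C then 1 else 0)"

definition principal_divisor :: "'k::field point set \<Rightarrow> ('k point \<Rightarrow> 'k) \<Rightarrow> 'k divisor" where
  "principal_divisor X \<phi> = (\<lambda>C. if C \<in> curves X then ord_along X C \<phi> else 0)"

definition reduced :: "'k divisor \<Rightarrow> bool" where
  "reduced D \<longleftrightarrow> (\<forall>C. D C = 0 \<or> D C = 1)"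

definition local_intersection ::
  "'k::field point set \<Rightarrow> 'k point set \<Rightarrow> 'k point set \<Rightarrow> 'k point \<Rightarrow> nat" where
  "local_intersection X C D p =
    quotient_dim (local_ring X p) (local_ideal X C p \<union> local_ideal X D p)"

text \<open>
  The intersection number of two curves that may coincide: replace \<open>C\<close> by a linearly equivalent
  divisor not containing \<open>D\<close>, and add up local intersection numbers of distinct curves.
\<close>

definition intersection_number ::
  "'k::field point set \<Rightarrow> 'k point set \<Rightarrow> 'k point set \<Rightarrow> int" where
  "intersection_number X C D = (THE n. \<exists>\<phi> \<Delta>. nonzero_rational X \<phi> \<and>
    \<Delta> = (\<lambda>E. prime_divisor C E + principal_divisor X \<phi> E) \<and> \<Delta> D = 0 \<and>
    n = (\<Sum>E\<in>components \<Delta>. \<Delta> E * (\<Sum>p\<in>E \<inter> D. int (local_intersection X E D p))))"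

definition smooth_rational_curve :: "'k::field point set \<Rightarrow> 'k point set \<Rightarrow> bool" where
  "smooth_rational_curve X C \<longleftrightarrow> C \<in> curves X \<and> isomorphic_varieties C (proj_space 1)"

definition minus_two_curve :: "'k::field point set \<Rightarrow> 'k point set \<Rightarrow> bool" where
  "minus_two_curve X C \<longleftrightarrow> smooth_rational_curve X C \<and> intersection_number X C C = - 2"


section \<open>Elliptic fibrations and their fibers\<close>

definition fiber :: "'k::field point set \<Rightarrow> ('k point \<Rightarrow> 'k point) \<Rightarrow> 'k point \<Rightarrow> 'k point set" where
  "fiber X g t = {p\<in>X. g p = t}"

definition coord_ratio :: "nat \<Rightarrow> nat \<Rightarrow> 'k::field point \<Rightarrow> 'k" where
  "coord_ratio i j s = (THE c. \<forall>b\<in>s. c = b i / b j)"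

text \<open>A rational function on \<open>P\<^sup>1\<close> that is a local parameter at \<open>t\<close> and vanishes at no other point of
  the affine chart around \<open>t\<close>.\<close>

definition local_parameter :: "'k::field point \<Rightarrow> 'k point \<Rightarrow> 'k" where
  "local_parameter t s = (if \<exists>b\<in>t. b 0 \<noteq> 0 then coord_ratio 1 0 s - coord_ratio 1 0 t
    else coord_ratio 0 1 s)"

text \<open>The scheme-theoretic fiber, that is the pullback of the divisor \<open>t\<close> on \<open>P\<^sup>1\<close>.\<close>

definition fiber_divisor ::
  "'k::field point set \<Rightarrow> ('k point \<Rightarrow> 'k point) \<Rightarrow> 'k point \<Rightarrow> 'k divisor" where
  "fiber_divisor X g t = (\<lambda>C. if C \<in> curves X \<and> C \<subseteq> fiber X g t
    then ord_along X C (\<lambda>p. local_parameter t (g p)) else 0)"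

definition smooth_fiber :: "'k::field point set \<Rightarrow> ('k point \<Rightarrow> 'k point) \<Rightarrow> 'k point \<Rightarrow> bool" where
  "smooth_fiber X g t \<longleftrightarrow> reduced (fiber_divisor X g t) \<and> smooth_of_dim (fiber X g t) 1"

definition elliptic_fibration :: "'k::field point set \<Rightarrow> ('k point \<Rightarrow> 'k point) \<Rightarrow> bool" where
  "elliptic_fibration X g \<longleftrightarrow> morphism X (proj_space 1) g \<and> g ` X = proj_space 1 \<and>
    (\<exists>S. finite S \<and> (\<forall>t\<in>proj_space 1 - S.
      smooth_fiber X g t \<and> zirreducible (fiber X g t) \<and> h1_O (fiber X g t) = 1))"

definition singular_fiber ::
  "'k::field point set \<Rightarrow> ('k point \<Rightarrow> 'k point) \<Rightarrow> 'k divisor \<Rightarrow> bool" where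
  "singular_fiber X g F \<longleftrightarrow>
    (\<exists>t\<in>proj_space 1. F = fiber_divisor X g t \<and> \<not> smooth_fiber X g t)"


section \<open>Dual graphs\<close>

text \<open>A multigraph without loops: a vertex set, and the number of edges joining two distinct vertices
  (the value on equal vertices is irrelevant).\<close>

type_synonym 'v multigraph = "'v set \<times> ('v \<Rightarrow> 'v \<Rightarrow> int)"

definition graph_iso :: "'v multigraph \<Rightarrow> 'w multigraph \<Rightarrow> bool" where
  "graph_iso G H \<longleftrightarrow> (\<exists>f. bij_betw f (fst G) (fst H) \<and>
    (\<forall>u\<in>fst G. \<forall>v\<in>fst G. u \<noteq> v \<longrightarrow> snd H (f u) (f v) = snd G u v))"

definition dual_graph :: "'k::field point set \<Rightarrow> 'k divisor \<Rightarrow> 'k point set multigraph" where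
  "dual_graph X D = (components D, intersection_number X)"

definition cycle_graph :: "nat \<Rightarrow> nat multigraph" where
  "cycle_graph n = ({..<n}, \<lambda>i j. if j = Suc i mod n \<or> i = Suc j mod n then 1 else 0)"

datatype dynkin = Dynkin_A nat | Dynkin_D nat | Dynkin_E6 | Dynkin_E7 | Dynkin_E8

fun dynkin_rank :: "dynkin \<Rightarrow> nat" where
  "dynkin_rank (Dynkin_A k) = k"
| "dynkin_rank (Dynkin_D l) = l"
| "dynkin_rank Dynkin_E6 = 6"
| "dynkin_rank Dynkin_E7 = 7"
| "dynkin_rank Dynkin_E8 = 8"

fun dynkin_valid :: "dynkin \<Rightarrow> bool" where
  "dynkin_valid (Dynkin_A k) \<longleftrightarrow> k \<ge> 1"
| "dynkin_valid (Dynkin_D l) \<longleftrightarrow> l \<ge> 4"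
| "dynkin_valid Dynkin_E6 \<longleftrightarrow> True"
| "dynkin_valid Dynkin_E7 \<longleftrightarrow> True"
| "dynkin_valid Dynkin_E8 \<longleftrightarrow> True"

text \<open>In types \<open>D\<close> and \<open>E\<close>, of rank \<open>m\<close>, the vertices \<open>0, \<dots>, m - 2\<close> form a path and the vertex
  \<open>m - 1\<close> is attached to the branch vertex, which is \<open>m - 3\<close> for \<open>D\<close> and \<open>2\<close> for \<open>E\<close>.\<close>

definition branched_path_edge :: "nat \<Rightarrow> nat \<Rightarrow> nat \<Rightarrow> nat \<Rightarrow> bool" where
  "branched_path_edge m b i j \<longleftrightarrow> j < m - 1 \<and> j = Suc i \<or> j = m - 1 \<and> i = b"

fun dynkin_edge :: "dynkin \<Rightarrow> nat \<Rightarrow> nat \<Rightarrow> bool" where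
  "dynkin_edge (Dynkin_A k) i j \<longleftrightarrow> j = Suc i"
| "dynkin_edge (Dynkin_D l) i j \<longleftrightarrow> branched_path_edge l (l - 3) i j"
| "dynkin_edge Dynkin_E6 i j \<longleftrightarrow> branched_path_edge 6 2 i j"
| "dynkin_edge Dynkin_E7 i j \<longleftrightarrow> branched_path_edge 7 2 i j"
| "dynkin_edge Dynkin_E8 i j \<longleftrightarrow> branched_path_edge 8 2 i j"

definition dynkin_diagram :: "dynkin \<Rightarrow> nat multigraph" where
  "dynkin_diagram T =
    ({..<dynkin_rank T}, \<lambda>i j. if dynkin_edge T i j \<or> dynkin_edge T j i then 1 else 0)"

definition disjoint_union_graph :: "'v multigraph list \<Rightarrow> (nat \<times> 'v) multigraph" where
  "disjoint_union_graph Gs = (SIGMA i:{..<length Gs}. fst (Gs ! i),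
    \<lambda>u v. if fst u = fst v then snd (Gs ! fst u) (snd u) (snd v) else 0)"

text \<open>\<open>D\<close> has type \<open>T\<^sub>1 \<oplus> \<dots> \<oplus> T\<^sub>r\<close> for \<open>Ts = [T\<^sub>1, \<dots>, T\<^sub>r]\<close>.\<close>

definition has_type :: "'k::field point set \<Rightarrow> 'k divisor \<Rightarrow> dynkin list \<Rightarrow> bool" where
  "has_type X D Ts \<longleftrightarrow>
    graph_iso (disjoint_union_graph (map dynkin_diagram Ts)) (dual_graph X D)"

text \<open>
  The last condition separates a cycle of three curves from three concurrent curves (Kodaira
  type IV), which have the same dual graph.
\<close>

definition kodaira_type_I :: "'k::field point set \<Rightarrow> 'k divisor \<Rightarrow> nat \<Rightarrow> bool" where
  "kodaira_type_I X F n \<longleftrightarrow> n \<ge> 3 \<and> reduced F \<and>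
    (\<forall>C\<in>components F. minus_two_curve X C) \<and>
    graph_iso (cycle_graph n) (dual_graph X F) \<and>
    (\<forall>C\<in>components F. \<forall>C'\<in>components F. C \<noteq> C' \<and> C \<inter> C' \<noteq> {} \<longrightarrow>
      (\<exists>p. C \<inter> C' = {p} \<and> local_intersection X C C' p = 1)) \<and>
    (\<forall>p. card {C\<in>components F. p \<in> C} \<le> 2)"

definition ADER :: "'k::field point set \<Rightarrow> 'k divisor \<Rightarrow> 'k divisor \<Rightarrow> bool" where
  "ADER X F R \<longleftrightarrow> reduced R \<and> (\<forall>C. R C \<le> F C) \<and> (\<exists>C. R C \<noteq> 0) \<and>
    (\<forall>C\<in>components R. minus_two_curve X C) \<and>
    (\<exists>Ts. (\<forall>T\<in>set Ts. dynkin_valid T) \<and> has_type X R Ts)"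

end

theory Submission
  imports Defs
begin

text \<open>
  A proper subset of the vertices of an \<open>n\<close>-cycle misses a vertex, so after a rotation it lies on a
  path with \<open>n - 1\<close> vertices. There it splits into maximal runs of consecutive vertices separated by
  gaps, which gives the inequality; conversely runs of prescribed lengths with gaps of length \<open>1\<close> fit
  on this path. The full cycle is no disjoint union of Dynkin diagrams, because each of these has a
  vertex with at most one neighbour.
\<close>

section \<open>Isomorphisms of multigraphs\<close>

lemma graph_iso_image:
  assumes "inj_on f S" "\<And>u v. u \<in> S \<Longrightarrow> v \<in> S \<Longrightarrow> u \<noteq> v \<Longrightarrow> e' (f u) (f v) = e u v"
  shows "graph_iso (S, e) (f ` S, e')"
  using assms unfolding graph_iso_def by (auto intro: inj_on_imp_bij_betw)

lemma graph_iso_trans: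
  assumes "graph_iso G H" "graph_iso H K"
  shows "graph_iso G K"
proof -
  obtain f where f: "bij_betw f (fst G) (fst H)"
    "\<forall>u\<in>fst G. \<forall>v\<in>fst G. u \<noteq> v \<longrightarrow> snd H (f u) (f v) = snd G u v"
    using assms(1) unfolding graph_iso_def by blast
  obtain h where h: "bij_betw h (fst H) (fst K)"
    "\<forall>u\<in>fst H. \<forall>v\<in>fst H. u \<noteq> v \<longrightarrow> snd K (h u) (h v) = snd H u v"
    using assms(2) unfolding graph_iso_def by blast
  have "snd K (h (f u)) (h (f v)) = snd G u v"
    if "u \<in> fst G" "v \<in> fst G" "u \<noteq> v" for u v
  proof -
    have "f u \<in> fst H" "f v \<in> fst H" "f u \<noteq> f v"
      using that f(1) by (auto simp: bij_betw_def inj_on_def)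
    with that f(2) h(2) show ?thesis by simp
  qed
  then show ?thesis
    unfolding graph_iso_def using bij_betw_trans[OF f(1) h(1)]
    by (intro exI[of _ "h \<circ> f"]) auto
qed

lemma graph_iso_sym:
  assumes "graph_iso G H"
  shows "graph_iso H G"
proof -
  obtain f where f: "bij_betw f (fst G) (fst H)"
    "\<forall>u\<in>fst G. \<forall>v\<in>fst G. u \<noteq> v \<longrightarrow> snd H (f u) (f v) = snd G u v"
    using assms unfolding graph_iso_def by blast
  define h where "h = inv_into (fst G) f"
  have bij: "bij_betw h (fst H) (fst G)"
    unfolding h_def by (rule bij_betw_inv_into[OF f(1)])
  have "snd G (h u) (h v) = snd H u v"
    if "u \<in> fst H" "v \<in> fst H" "u \<noteq> v" for u v
  proof -
    have "f (h u) = u" "f (h v) = v"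
      using that f(1) by (auto simp: h_def bij_betw_inv_into_right)
    moreover from this have "h u \<noteq> h v" using that by auto
    moreover have "h u \<in> fst G" "h v \<in> fst G"
      using that bij by (auto simp: bij_betw_def)
    ultimately show ?thesis using f(2) by metis
  qed
  with bij show ?thesis unfolding graph_iso_def by blast
qed

lemma graph_iso_disjoint_union_Nil: "graph_iso (disjoint_union_graph []) ({}, e)"
  by (simp add: graph_iso_def disjoint_union_graph_def bij_betw_def)

text \<open>Appending at the end keeps the indices of the old summands, so the map on
  \<open>Gs\<close> is reused unchanged. \<open>cross\<close> mirrors the zero multiplicity between
  different summands.\<close>

lemma graph_iso_disjoint_union_snoc:
  assumes "graph_iso (disjoint_union_graph Gs) (U, e)" "graph_iso G (V, e)"
    and "U \<inter> V = {}"
    and cross: "\<And>u v. u \<in> U \<Longrightarrow> v \<in> V \<Longrightarrow> e u v = 0 \<and> e v u = 0"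
  shows "graph_iso (disjoint_union_graph (Gs @ [G])) (U \<union> V, e)"
proof -
  let ?D = "disjoint_union_graph Gs" and ?D' = "disjoint_union_graph (Gs @ [G])"
  let ?m = "length Gs"
  obtain f where f: "bij_betw f (fst ?D) U"
    "\<forall>u\<in>fst ?D. \<forall>v\<in>fst ?D. u \<noteq> v \<longrightarrow> e (f u) (f v) = snd ?D u v"
    using assms(1) unfolding graph_iso_def by auto
  obtain h where h: "bij_betw h (fst G) V"
    "\<forall>u\<in>fst G. \<forall>v\<in>fst G. u \<noteq> v \<longrightarrow> e (h u) (h v) = snd G u v"
    using assms(2) unfolding graph_iso_def by auto
  define k where "k w = (if fst w < ?m then f w else h (snd w))" for w
  have vertices: "fst ?D' = fst ?D \<union> {?m} \<times> fst G"
    by (auto simp: disjoint_union_graph_def nth_append less_Suc_eq)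
  have lt: "fst w < ?m" if "w \<in> fst ?D" for w
    using that by (auto simp: disjoint_union_graph_def)
  have "bij_betw k (fst ?D) U"
    using f(1) by (subst bij_betw_cong[of _ k f]) (auto simp: k_def lt)
  moreover have "bij_betw k ({?m} \<times> fst G) V"
  proof -
    have "bij_betw snd ({?m} \<times> fst G) (fst G)"
      by (auto simp: bij_betw_def inj_on_def)
    from bij_betw_trans[OF this h(1)] show ?thesis
      by (subst bij_betw_cong[of _ k "h \<circ> snd"]) (auto simp: k_def)
  qed
  ultimately have bij: "bij_betw k (fst ?D') (U \<union> V)"
    unfolding vertices using assms(3) by (rule bij_betw_combine)
  have fU: "f w \<in> U" if "w \<in> fst ?D" for w using f(1) that by (auto simp: bij_betw_def)
  have hV: "h x \<in> V" if "x \<in> fst G" for x using h(1) that by (auto simp: bij_betw_def)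
  have "e (k u) (k v) = snd ?D' u v"
    if uv: "u \<in> fst ?D'" "v \<in> fst ?D'" "u \<noteq> v" for u v
  proof -
    consider "u \<in> fst ?D" "v \<in> fst ?D" | "u \<in> fst ?D" "v \<in> {?m} \<times> fst G"
      | "u \<in> {?m} \<times> fst G" "v \<in> fst ?D" | "u \<in> {?m} \<times> fst G" "v \<in> {?m} \<times> fst G"
      using uv vertices by blast
    then show ?thesis
    proof cases
      case 1
      then have "e (k u) (k v) = snd ?D u v" using f(2) uv(3) lt by (simp add: k_def)
      also have "\<dots> = snd ?D' u v"
        using lt[OF 1(1)] by (simp add: disjoint_union_graph_def nth_append)
      finally show ?thesis .
    next
      case 2
      then have "k u \<in> U" "k v \<in> V" using lt[OF 2(1)] fU hV by (auto simp: k_def)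
      with 2 lt[OF 2(1)] cross show ?thesis by (auto simp: disjoint_union_graph_def)
    next
      case 3
      then have "k u \<in> V" "k v \<in> U" using lt[OF 3(2)] fU hV by (auto simp: k_def)
      with 3 lt[OF 3(2)] cross show ?thesis by (auto simp: disjoint_union_graph_def)
    next
      case 4
      then have "snd u \<noteq> snd v" using uv(3) by auto
      with 4 h(2) show ?thesis by (auto simp: k_def disjoint_union_graph_def)
    qed
  qed
  with bij show ?thesis unfolding graph_iso_def by (intro exI[of _ k]) simp
qed

section \<open>Subsets of a path\<close>

text \<open>The infinite path on the naturals. Every finite piece is an induced subgraph of it, so
  only the vertex set varies below.\<close>

definition path_adj :: "nat \<Rightarrow> nat \<Rightarrow> int" where
  "path_adj i j = (if j = Suc i \<or> i = Suc j then 1 else 0)"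

abbreviation A_union :: "nat list \<Rightarrow> (nat \<times> nat) multigraph" where
  "A_union ls \<equiv> disjoint_union_graph (map dynkin_diagram (map Dynkin_A ls))"

lemma A_iso_interval: "graph_iso (dynkin_diagram (Dynkin_A k)) ({a..<a + k}, path_adj)"
proof -
  have "dynkin_diagram (Dynkin_A k) = ({..<k}, path_adj)"
    by (auto simp: dynkin_diagram_def path_adj_def fun_eq_iff)
  moreover have "graph_iso ({..<k}, path_adj) ((\<lambda>i. i + a) ` {..<k}, path_adj)"
    by (rule graph_iso_image) (auto simp: path_adj_def)
  moreover have "(\<lambda>i. i + a) ` {..<k} = {a..<a + k}"
    using image_add_atLeastLessThan'[of a 0 k] by (simp add: atLeast0LessThan add.commute)
  ultimately show ?thesis by simp
qed

text \<open>The bound \<open>Suc i < a\<close> keeps vertex \<open>a - 1\<close> free, and this gap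
  rules out edges between \<open>S\<close> and the new run.\<close>

lemma A_union_snoc_interval:
  assumes "graph_iso (A_union ls) (S, path_adj)" "\<And>i. i \<in> S \<Longrightarrow> Suc i < a"
  shows "graph_iso (A_union (ls @ [k])) (S \<union> {a..<a + k}, path_adj)"
proof -
  have "graph_iso (disjoint_union_graph (map dynkin_diagram (map Dynkin_A ls) @
      [dynkin_diagram (Dynkin_A k)])) (S \<union> {a..<a + k}, path_adj)"
    using assms(1) A_iso_interval
    by (rule graph_iso_disjoint_union_snoc) (use assms(2) in \<open>fastforce simp: path_adj_def\<close>)+
  then show ?thesis by simp
qed

text \<open>Each run of length \<open>l\<close> takes \<open>l + 1\<close> positions, the last one
  being its gap, so the next run starts at \<open>sum_list ls + length ls\<close>. The strict bound
  records that the final position is a gap too.\<close>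

lemma A_union_in_path:
  "\<exists>S. (\<forall>i\<in>S. Suc i < sum_list ls + length ls) \<and> graph_iso (A_union ls) (S, path_adj)"
proof (induction ls rule: rev_induct)
  case Nil
  show ?case using graph_iso_disjoint_union_Nil by (intro exI[of _ "{}"]) simp
next
  case (snoc k ls)
  then obtain S where "\<forall>i\<in>S. Suc i < sum_list ls + length ls" "graph_iso (A_union ls) (S, path_adj)"
    by blast
  with A_union_snoc_interval[of ls S "sum_list ls + length ls" k] show ?case
    by (intro exI[of _ "S \<union> {sum_list ls + length ls..<sum_list ls + length ls + k}"]) auto
qed

text \<open>Induction that splits off the last maximal run. Each run is charged one extra position
  for the gap after it; the last run may end at \<open>m - 1\<close>, whence \<open>Suc m\<close> in
  the bound.\<close>

lemma subset_path_A_union: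
  assumes "S \<subseteq> {..<m}"
  shows "\<exists>ls. (\<forall>l\<in>set ls. 1 \<le> l) \<and> sum_list ls + length ls \<le> Suc m \<and>
    graph_iso (A_union ls) (S, path_adj)"
  using assms
proof (induction m arbitrary: S rule: less_induct)
  case (less m)
  show ?case
  proof (cases "S = {}")
    case True
    then show ?thesis using graph_iso_disjoint_union_Nil by (intro exI[of _ "[]"]) simp
  next
    case False
    define b where "b = Suc (Max S)"
    have fin: "finite S" using less.prems finite_subset by blast
    have b: "b \<le> m" "\<And>i. i \<in> S \<Longrightarrow> i < b" "b - 1 \<in> S" "b > 0"
      using fin less.prems Max_in[OF fin False] by (auto simp: b_def le_imp_less_Suc Suc_le_eq)
    \<comment> \<open>The start of the maximal run ending at \<open>b - 1\<close>. The empty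
      interval \<open>{b..<b}\<close> shows that the minimum exists; minimality yields the gap
      before the run.\<close>
    define a where "a = (LEAST a. {a..<b} \<subseteq> S)"
    have run: "{a..<b} \<subseteq> S" unfolding a_def by (rule LeastI[of _ b]) simp
    have "{b - 1..<b} \<subseteq> S" using b(3,4) by (cases b) (auto simp: le_less_Suc_eq)
    then have "a \<le> b - 1" unfolding a_def by (rule Least_le)
    with b have ab: "a < b" by simp
    have gap: "i \<notin> S" if "Suc i = a" for i
    proof
      assume "i \<in> S"
      moreover have "{i..<b} \<subseteq> insert i {a..<b}" using that by auto
      ultimately have "{i..<b} \<subseteq> S" using run by blast
      then have "a \<le> i" unfolding a_def by (rule Least_le)
      with that show False by simp
    qed
    define S' where "S' = S \<inter> {..<a}"
    have S: "S = S' \<union> {a..<a + (b - a)}" using run b(2) ab by (auto simp: S'_def)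
    have small: "Suc i < a" if "i \<in> S'" for i
      using that gap[of i] by (auto simp: S'_def intro: Suc_lessI)
    obtain ls where ls: "\<forall>l\<in>set ls. 1 \<le> l" "sum_list ls + length ls \<le> a"
      "graph_iso (A_union ls) (S', path_adj)"
    \<comment> \<open>Either the run starts at \<open>0\<close> and nothing is left, or
      \<open>a = Suc c\<close> with \<open>c\<close> a gap. Then the rest lies below
      \<open>c\<close>, and the induction bound \<open>Suc c\<close> is exactly
      \<open>a\<close>.\<close>
    proof (cases a)
      case 0
      then have "S' = {}" by (simp add: S'_def)
      then show ?thesis using that[of "[]"] graph_iso_disjoint_union_Nil[of path_adj] by simp
    next
      case (Suc c)
      then have "S' \<subseteq> {..<c}" using small by auto
      moreover have "c < m" using Suc ab b(1) by simp
      ultimately show ?thesis using less.IH[of c S'] that Suc by auto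
    qed
    have "graph_iso (A_union (ls @ [b - a])) (S, path_adj)"
      unfolding S using ls(3) small by (rule A_union_snoc_interval)
    with ls ab b(1) show ?thesis by (intro exI[of _ "ls @ [b - a]"]) auto
  qed
qed

section \<open>Subsets of a cycle\<close>

lemma fst_cycle_graph: "fst (cycle_graph n) = {..<n}"
  by (simp add: cycle_graph_def)

text \<open>Away from vertex \<open>n - 1\<close> successors stay below \<open>n\<close>, so the
  reduction modulo \<open>n\<close> does nothing.\<close>

lemma cycle_adj_path_adj:
  assumes "i < n - 1" "j < n - 1"
  shows "snd (cycle_graph n) i j = path_adj i j"
  using assms by (simp add: cycle_graph_def path_adj_def)

text \<open>Giving a chosen vertex the last label puts every vertex set that avoids it on the path
  \<open>{..<n - 1}\<close>.\<close>

lemma cycle_rotation: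
  assumes "graph_iso (cycle_graph n) H" "c \<in> fst H"
  obtains f where "bij_betw f {..<n} (fst H)" "f (n - 1) = c"
    "\<And>i j. i < n \<Longrightarrow> j < n \<Longrightarrow> i \<noteq> j \<Longrightarrow> snd H (f i) (f j) = snd (cycle_graph n) i j"
proof -
  obtain h where h: "bij_betw h {..<n} (fst H)"
    "\<And>i j. i < n \<Longrightarrow> j < n \<Longrightarrow> i \<noteq> j \<Longrightarrow> snd H (h i) (h j) = snd (cycle_graph n) i j"
    using assms(1) unfolding graph_iso_def fst_cycle_graph by (metis lessThan_iff)
  obtain d where d: "d < n" "h d = c"
    using h(1) assms(2) unfolding bij_betw_def by (metis imageE lessThan_iff)
  \<comment> \<open>The shift is chosen so that \<open>n - 1\<close> goes to \<open>n + d\<close>,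
    that is to \<open>d\<close> modulo \<open>n\<close>.\<close>
  define r where "r i = (i + Suc d) mod n" for i
  have cong: "r i = r j \<longleftrightarrow> i mod n = j mod n" for i j
    by (simp add: r_def nat_mod_eq_iff)
  have r_lt: "r i < n" for i using d by (simp add: r_def)
  have inj: "inj_on r {..<n}" by (auto simp: inj_on_def cong)
  then have "bij_betw r {..<n} {..<n}"
    unfolding bij_betw_def using r_lt endo_inj_surj[of "{..<n}" r] by auto
  then have "bij_betw (h \<circ> r) {..<n} (fst H)" using h(1) by (rule bij_betw_trans)
  moreover have "(h \<circ> r) (n - 1) = c" using d by (simp add: r_def)
  moreover have "snd H ((h \<circ> r) i) ((h \<circ> r) j) = snd (cycle_graph n) i j"
    if ij: "i < n" "j < n" "i \<noteq> j" for i j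
  proof -
    \<comment> \<open>The rotation commutes with the cyclic successor and therefore preserves
      adjacency.\<close>
    have step: "r l = Suc (r k) mod n \<longleftrightarrow> l = Suc k mod n" if "l < n" for k l
    proof -
      have "Suc (r k) mod n = r (Suc k)" by (simp add: r_def mod_Suc_eq)
      then show ?thesis using that by (simp add: cong)
    qed
    have "r i \<noteq> r j" using ij inj by (auto simp: inj_on_def)
    then have "snd H (h (r i)) (h (r j)) = snd (cycle_graph n) (r i) (r j)"
      using h(2) r_lt by blast
    also have "\<dots> = snd (cycle_graph n) i j"
      using ij by (simp add: cycle_graph_def step)
    finally show ?thesis by simp
  qed
  ultimately show thesis by (rule that)
qed

text \<open>Vertex \<open>0\<close> is an end of the path, and validity keeps the branch vertex away
  from it: \<open>l - 3\<close> is positive for \<open>l \<ge> 4\<close>, and in type E it is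
  \<open>2\<close>.\<close>

lemma dynkin_end_vertex:
  assumes "dynkin_valid T" "dynkin_edge T 0 j \<or> dynkin_edge T j 0"
  shows "j = 1"
  using assms by (cases T) (auto simp: branched_path_edge_def)

text \<open>Vertex \<open>0\<close> of the first summand has at most one neighbour, whereas every
  vertex of a cycle with \<open>n \<ge> 3\<close> has two.\<close>

lemma cycle_not_dynkin:
  assumes "n \<ge> 3" "\<forall>T\<in>set Ts. dynkin_valid T"
  shows "\<not> graph_iso (disjoint_union_graph (map dynkin_diagram Ts)) (cycle_graph n)"
proof
  let ?D = "disjoint_union_graph (map dynkin_diagram Ts)"
  assume "graph_iso ?D (cycle_graph n)"
  then obtain f where f: "bij_betw f (fst ?D) {..<n}"
    "\<forall>u\<in>fst ?D. \<forall>v\<in>fst ?D. u \<noteq> v \<longrightarrow> snd (cycle_graph n) (f u) (f v) = snd ?D u v"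
    unfolding graph_iso_def by (auto simp: cycle_graph_def)
  have "Ts \<noteq> []"
  proof
    assume "Ts = []"
    then have "{..<n} = {}" using f(1) by (simp add: disjoint_union_graph_def bij_betw_def)
    then show False using assms(1) by (simp add: lessThan_empty_iff)
  qed
  then have valid: "dynkin_valid (Ts ! 0)" using assms(2) by (cases Ts) auto
  then have "dynkin_rank (Ts ! 0) > 0" by (cases "Ts ! 0") auto
  then have v0: "(0, 0) \<in> fst ?D"
    using \<open>Ts \<noteq> []\<close> by (auto simp: disjoint_union_graph_def dynkin_diagram_def)
  define v where "v = f (0, 0)"
  have v: "v < n" using f(1) v0 by (auto simp: v_def bij_betw_def)
  \<comment> \<open>If the first summand has a single vertex, \<open>(0, 1)\<close> is not a vertex
    and \<open>f (0, 1)\<close> is arbitrary, but then no such \<open>x\<close> exists.\<close>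
  have unique: "x = f (0, 1)"
    if x: "x < n" "x \<noteq> v" "snd (cycle_graph n) v x = 1" for x
  proof -
    obtain w where w: "w \<in> fst ?D" "x = f w"
      using x(1) f(1) unfolding bij_betw_def by (metis imageE lessThan_iff)
    have "w \<noteq> (0, 0)" using w x(2) by (auto simp: v_def)
    then have "snd ?D (0, 0) w = snd (cycle_graph n) v x" using w v0 f(2) by (simp add: v_def)
    then have "snd ?D (0, 0) w = 1" using x(3) by simp
    then have "fst w = 0" "dynkin_edge (Ts ! 0) 0 (snd w) \<or> dynkin_edge (Ts ! 0) (snd w) 0"
      using \<open>Ts \<noteq> []\<close>
      by (auto simp: disjoint_union_graph_def dynkin_diagram_def split: if_splits)
    then have "w = (0, 1)" using dynkin_end_vertex[OF valid] by (simp add: prod_eq_iff)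
    with w show ?thesis by simp
  qed
  \<comment> \<open>\<open>s\<close> and \<open>p\<close> are the cyclic successor and predecessor
    of \<open>v\<close>; they differ because \<open>n \<ge> 3\<close>.\<close>
  define s where "s = Suc v mod n"
  define p where "p = (if v = 0 then n - 1 else v - 1)"
  have sp: "s < n" "p < n" "s \<noteq> v" "p \<noteq> v" "s \<noteq> p" "v = Suc p mod n"
    using v assms(1) by (auto simp: s_def p_def mod_Suc)
  have "snd (cycle_graph n) v s = 1" "snd (cycle_graph n) v p = 1"
    unfolding cycle_graph_def snd_conv using s_def sp(6) by auto
  with unique sp have "s = f (0, 1)" "p = f (0, 1)" by blast+
  with sp show False by simp
qed

section \<open>Reduced subdivisors of a cycle of curves\<close>

text \<open>Coefficients are integers, so \<open>R C \<le> F C\<close> alone would allow a negative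
  \<open>R C\<close> where \<open>F C\<close> is \<open>0\<close>; reducedness excludes
  this.\<close>

lemma components_reduced_subdivisor:
  assumes "reduced R" "\<forall>C. R C \<le> F C"
  shows "components R \<subseteq> components F"
proof
  fix C assume "C \<in> components R"
  then have "R C = 1" using assms(1) by (auto simp: components_def reduced_def)
  moreover have "R C \<le> F C" using assms(2) by blast
  ultimately show "C \<in> components F" by (simp add: components_def)
qed

text \<open>On \<open>S\<close>, which avoids the label \<open>n - 1\<close>, the labelling
  \<open>f\<close> identifies the induced path with the dual graph of \<open>R\<close>. The
  equivalence serves both halves of the theorem.\<close>

lemma has_type_transfer:
  assumes "bij_betw f {..<n} V"
    and "\<And>i j. i < n \<Longrightarrow> j < n \<Longrightarrow> i \<noteq> j \<Longrightarrow>
      intersection_number X (f i) (f j) = snd (cycle_graph n) i j"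
    and "S \<subseteq> {..<n - 1}" "components R = f ` S"
  shows "has_type X R (map Dynkin_A ls) \<longleftrightarrow> graph_iso (A_union ls) (S, path_adj)"
proof -
  have "graph_iso (S, path_adj) (f ` S, intersection_number X)"
  proof (rule graph_iso_image)
    show "inj_on f S"
      by (rule inj_on_subset[OF bij_betw_imp_inj_on[OF assms(1)]]) (use assms(3) in auto)
    fix i j assume "i \<in> S" "j \<in> S" "i \<noteq> j"
    moreover from this have "i < n - 1" "j < n - 1" using assms(3) by auto
    ultimately show "intersection_number X (f i) (f j) = path_adj i j"
      using assms(2)[of i j] cycle_adj_path_adj[of i n j] by simp
  qed
  then have iso: "graph_iso (S, path_adj) (dual_graph X R)"
    by (simp add: dual_graph_def assms(4))
  show ?thesis
    unfolding has_type_def using graph_iso_trans[OF _ iso] graph_iso_trans[OF _ graph_iso_sym[OF iso]]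
    by blast
qed

text \<open>The given Dynkin type shows that \<open>R\<close> misses a component \<open>c\<close> of
  the cycle. With \<open>c\<close> rotated to \<open>n - 1\<close>, the type is read off from the
  runs of the remaining labels.\<close>

lemma ADER_type:
  assumes "kodaira_type_I X F n" "ADER X F R"
  shows "\<exists>ls. ls \<noteq> [] \<and> (\<forall>l\<in>set ls. l \<ge> 1) \<and> sum_list ls + length ls \<le> n \<and>
    has_type X R (map Dynkin_A ls)"
proof -
  have n: "n \<ge> 3" and cyc: "graph_iso (cycle_graph n) (dual_graph X F)"
    using assms(1) by (simp_all add: kodaira_type_I_def)
  obtain Ts where Ts: "\<forall>T\<in>set Ts. dynkin_valid T" "has_type X R Ts"
    using assms(2) by (auto simp: ADER_def)
  have sub: "components R \<subseteq> components F"
    using assms(2) by (intro components_reduced_subdivisor) (auto simp: ADER_def)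
  have nonempty: "components R \<noteq> {}" using assms(2) by (auto simp: ADER_def components_def)
  have "components R \<noteq> components F"
  proof
    assume "components R = components F"
    then have "graph_iso (disjoint_union_graph (map dynkin_diagram Ts)) (dual_graph X F)"
      using Ts(2) by (simp add: has_type_def dual_graph_def)
    then have "graph_iso (disjoint_union_graph (map dynkin_diagram Ts)) (cycle_graph n)"
      using graph_iso_sym[OF cyc] by (rule graph_iso_trans)
    with cycle_not_dynkin[OF n Ts(1)] show False by blast
  qed
  with sub obtain c where c: "c \<in> components F" "c \<notin> components R" by blast
  obtain f where f: "bij_betw f {..<n} (components F)" "f (n - 1) = c"
    "\<And>i j. i < n \<Longrightarrow> j < n \<Longrightarrow> i \<noteq> j \<Longrightarrow>
      intersection_number X (f i) (f j) = snd (cycle_graph n) i j"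
    using cycle_rotation[OF cyc, of c] c(1) by (auto simp: dual_graph_def)
  define S where "S = {i. i < n \<and> f i \<in> components R}"
  have S: "S \<subseteq> {..<n - 1}"
  proof
    fix i assume "i \<in> S"
    then have "i < n" "i \<noteq> n - 1" using f(2) c(2) by (auto simp: S_def)
    then show "i \<in> {..<n - 1}" by simp
  qed
  have "components F = f ` {..<n}" using f(1) by (simp add: bij_betw_def)
  then have "components R \<subseteq> f ` {..<n}" using sub by simp
  then have R: "components R = f ` S" by (auto simp: S_def)
  obtain ls where ls: "\<forall>l\<in>set ls. 1 \<le> l" "sum_list ls + length ls \<le> Suc (n - 1)"
    "graph_iso (A_union ls) (S, path_adj)"
    using subset_path_A_union[OF S] by blast
  \<comment> \<open>An empty list would leave \<open>R\<close> without components, but an ADER is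
    nonzero.\<close>
  have "ls \<noteq> []"
  proof
    assume "ls = []"
    then have "S = {}"
      using ls(3) by (auto simp: graph_iso_def disjoint_union_graph_def bij_betw_def)
    with R nonempty show False by simp
  qed
  moreover have "has_type X R (map Dynkin_A ls)"
    using has_type_transfer[OF f(1,3) S R] ls(3) by simp
  moreover have "sum_list ls + length ls \<le> n" using ls(2) n by simp
  ultimately show ?thesis using ls(1) by (intro exI[of _ ls]) simp
qed

text \<open>The runs are laid out on the labels of the cycle, and \<open>R\<close> is the sum of the
  curves they mark.\<close>

lemma ADER_exists:
  assumes "kodaira_type_I X F n"
    and "ls \<noteq> []" "\<forall>l\<in>set ls. l \<ge> 1" "sum_list ls + length ls \<le> n"
  shows "\<exists>R. ADER X F R \<and> has_type X R (map Dynkin_A ls)"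
proof -
  have red: "reduced F" and curves: "\<forall>C\<in>components F. minus_two_curve X C"
    and cyc: "graph_iso (cycle_graph n) (dual_graph X F)"
    using assms(1) by (simp_all add: kodaira_type_I_def)
  obtain f where f: "bij_betw f {..<n} (components F)"
    "\<And>i j. i < n \<Longrightarrow> j < n \<Longrightarrow> i \<noteq> j \<Longrightarrow>
      intersection_number X (f i) (f j) = snd (cycle_graph n) i j"
    using cyc unfolding graph_iso_def fst_cycle_graph dual_graph_def fst_conv snd_conv
    by (metis lessThan_iff)
  obtain S where S: "\<forall>i\<in>S. Suc i < sum_list ls + length ls"
    "graph_iso (A_union ls) (S, path_adj)"
    using A_union_in_path by blast
  \<comment> \<open>The gap after the last run leaves label \<open>n - 1\<close> free, so the first
    and last runs do not meet around the cycle.\<close>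
  have Sn: "S \<subseteq> {..<n - 1}"
  proof
    fix i assume "i \<in> S"
    with S(1) have "Suc i < sum_list ls + length ls" by blast
    with assms(4) show "i \<in> {..<n - 1}" by simp
  qed
  define R :: "'a divisor" where "R C = (if C \<in> f ` S then 1 else 0)" for C
  have R: "components R = f ` S" by (auto simp: components_def R_def)
  have comps: "f ` S \<subseteq> components F"
  proof -
    have "S \<subseteq> {..<n}" using Sn by (rule order_trans) auto
    then have "f ` S \<subseteq> f ` {..<n}" by (rule image_mono)
    then show ?thesis using f(1) by (simp add: bij_betw_def)
  qed
  have "\<forall>C\<in>components R. minus_two_curve X C"
    unfolding R using bspec[OF curves subsetD[OF comps]] by (rule ballI)
  moreover have "R C \<le> F C" for C
  proof -
    have "F C = 0 \<or> F C = 1" using red by (simp add: reduced_def)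
    moreover have "F C \<noteq> 0" if "C \<in> f ` S" using subsetD[OF comps that] by (simp add: components_def)
    ultimately show ?thesis by (auto simp: R_def)
  qed
  moreover have "\<exists>C. R C \<noteq> 0"
  proof -
    \<comment> \<open>The first run has length at least \<open>1\<close>; this makes
      \<open>R\<close> nonzero.\<close>
    have "(0, 0) \<in> fst (A_union ls)"
      using assms(2,3) by (cases ls) (auto simp: disjoint_union_graph_def dynkin_diagram_def)
    then have "S \<noteq> {}" using S(2) by (auto simp: graph_iso_def bij_betw_def)
    then show ?thesis by (auto simp: R_def)
  qed
  moreover have type: "has_type X R (map Dynkin_A ls)"
    using has_type_transfer[OF f Sn R] S(2) by simp
  moreover have "reduced R" by (simp add: reduced_def R_def)
  moreover have "\<forall>T\<in>set (map Dynkin_A ls). dynkin_valid T" using assms(3) by auto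
  ultimately have "ADER X F R"
    unfolding ADER_def by (intro conjI allI exI[of _ "map Dynkin_A ls"])
  with type show ?thesis by (intro exI[of _ R] conjI)
qed

theorem proposition9p1:
  fixes X :: "'k::{alg_closed_field, field_char_0} point set"
    and g :: "'k point \<Rightarrow> 'k point"
    and F :: "'k divisor"
    and n :: nat
  assumes "K3_surface X"
    and "elliptic_fibration X g"
    and "singular_fiber X g F"
    and "n \<ge> 3"
    and "kodaira_type_I X F n"
  shows "(\<forall>R. ADER X F R \<longrightarrow>
            (\<exists>ls::nat list. ls \<noteq> [] \<and> (\<forall>l\<in>set ls. l \<ge> 1) \<and> sum_list ls + length ls \<le> n \<and>
              has_type X R (map Dynkin_A ls))) \<and>
         (\<forall>ls::nat list. ls \<noteq> [] \<and> (\<forall>l\<in>set ls. l \<ge> 1) \<and> sum_list ls + length ls \<le> n \<longrightarrow>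
            (\<exists>R. ADER X F R \<and> has_type X R (map Dynkin_A ls)))"
  using ADER_type[OF assms(5)] ADER_exists[OF assms(5)] by simp

end
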